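(* Consider the following system of lattice equations (higher Gel'fand-Dikii system) for three functions $\tau,\varphi,\psi$ on $\mathbb{Z}^2$, with generic constants $p,q,\omega_1,\omega_2,\omega_3$, required to hold at every $(l,m)\in\mathbb{Z}^2$: $$(p-q)\,\tau_{0,0}\,\varphi_{1,1}+(q-\omega_1)\,\tau_{0,1}\,\varphi_{1,0}+(\omega_1-p)\,\tau_{1,0}\,\varphi_{0,1}=0,$$ $$(p-q)\,\tau_{1,1}\,\psi_{0,0}+(q-\omega_2)\,\tau_{1,0}\,\psi_{0,1}+(\omega_2-p)\,\tau_{0,1}\,\psi_{1,0}=0,$$ $$(p-q)\,\varphi_{-1,0}\,\psi_{1,1}+(q-\omega_3)\,\varphi_{-1,1}\,\psi_{1,0}+(\omega_3-p)\,\varphi_{0,0}\,\psi_{0,1}=0.$$ (a) Let $\mathbf{s}=(s_1,s_2)\in\mathbb{Z}^2$ with $s_1,s_2>0$. Then a well-posed initial value (Cauchy) problem with direction $\mathbf{s}$ is obtained by squeezing the combined stencil consisting of the points $(0,1),(2,0)$ for $\tau$, the points $(0,1),(1,0)$ for $\varphi$, and the points $(1,1),(2,0)$ for $\psi$. Explicitly, with $n(l,m)=s_2l-s_1m$, the initial values are: $\tau(l,m)$ for $-s_1\le n(l,m)<2s_2$; $\varphi(l,m)$ for $-s_1\le n(l,m)<s_2$; $\psi(l,m)$ for $s_2-s_1\le n(l,m)<2s_2$. (b) Let $\mathbf{s}=(s_1,s_2)\in\mathbb{Z}^2$ with $s_1>0$, $s_2<0$. Then a well-posed initial value problem with direction $\mathbf{s}$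 is obtained by squeezing the combined stencil consisting of the points $(0,0),(2,1)$ for $\tau$, the points $(0,0),(1,1)$ for $\varphi$, and the points $(1,0),(2,1)$ for $\psi$. Explicitly, with $n(l,m)=|s_2|l+s_1m$, the initial values are: $\tau(l,m)$ for $0\le n(l,m)<2|s_2|+s_1$; $\varphi(l,m)$ for $0\le n(l,m)<|s_2|+s_1$; $\psi(l,m)$ for $|s_2|\le n(l,m)<2|s_2|+s_1$.
   Context: Notation: $\tau_{i,j}=\tau(l+i,m+j)$, similarly for $\varphi,\psi$. In the paper $\omega_i=\omega_i(p)$ are the roots other than $p$ of $\omega^4+\alpha\omega^3+\beta\omega^2+\gamma\omega=p^4+\alpha p^3+\beta p^2+\gamma p$; generic constants means that all coefficients $p-q$, $q-\omega_i$, $\omega_i-p$ are nonzero. Squeezing a combined stencil with direction $\mathbf{s}$: for each of the three variables one draws the two lines of direction $\mathbf{s}$ through the two stencil points belonging to that variable; the lattice points in the band between these two lines (including those on the left line, excluding those on the right line) carry the initial values of that variable. This gives one straight band of initial values for each variable. The initial value problem is well-posed if, for generic initial values on the bands (values regarded as independent indeterminates over the field containing the constants), there is one and only one solution $(\tau,\varphi,\psi)$ of the system on the whole of $\mathbb{Z}^2$ with these initial values (its values being rational functions of the initial values), determined by successively solving the equations for the values on the lines bounding the bands, in both directions away from the bands. *)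

theory Defs
  imports
    "HOL-Library.Poly_Mapping"
    "HOL-Library.Product_Lexorder"
    "HOL-Computational_Algebra.Polynomial_Factorial"
begin

section \<open>Lattice sites\<close>

datatype dvar = Tau | Phi | Psi

text \<open>The order only serves to make the polynomial ring below an instance of \<^class>\<open>idom\<close>.\<close>

instantiation dvar :: linorder
begin

definition less_eq_dvar :: "dvar \<Rightarrow> dvar \<Rightarrow> bool" where
  "x \<le> y \<longleftrightarrow> x = Tau \<or> (x = Phi \<and> y \<noteq> Tau) \<or> y = Psi"

definition less_dvar :: "dvar \<Rightarrow> dvar \<Rightarrow> bool" where
  "x < y \<longleftrightarrow> x \<le> y \<and> x \<noteq> (y :: dvar)"

instance
proof
  fix x y z :: dvar
  show "(x < y) = (x \<le> y \<and> \<not> y \<le> x)"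
    by (cases x; cases y) (simp_all add: less_dvar_def less_eq_dvar_def)
  show "x \<le> x"
    by (cases x) (simp_all add: less_eq_dvar_def)
  show "x \<le> z" if "x \<le> y" "y \<le> z"
    using that by (cases x; cases y; cases z) (simp_all add: less_eq_dvar_def)
  show "x = y" if "x \<le> y" "y \<le> x"
    using that by (cases x; cases y) (simp_all add: less_eq_dvar_def)
  show "x \<le> y \<or> y \<le> x"
    by (cases x; cases y) (simp_all add: less_eq_dvar_def)
qed

end

type_synonym point = "int \<times> int"

text \<open>A triple of functions on the lattice is a single function \<open>u\<close> on sites:
  \<open>\<tau>(l,m) = u (Tau, l, m)\<close>, and similarly for the other two variables.\<close>

type_synonym site = "dvar \<times> point"


section \<open>Rational functions in indeterminates indexed by sites\<close>

type_synonym 'k site_poly = "(site \<Rightarrow>\<^sub>0 nat) \<Rightarrow>\<^sub>0 'k"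
type_synonym 'k ratfun = "'k site_poly fract"

definition const :: "'k::field \<Rightarrow> 'k ratfun" where
  "const c = to_fract (Poly_Mapping.single 0 c)"

definition indet :: "site \<Rightarrow> 'k::field ratfun" where
  "indet a = to_fract (Poly_Mapping.single (Poly_Mapping.single a 1) 1)"

definition vars :: "'k::field site_poly \<Rightarrow> site set" where
  "vars P = (\<Union>mon \<in> Poly_Mapping.keys P. Poly_Mapping.keys mon)"

definition ratfuns_in :: "site set \<Rightarrow> 'k::field ratfun set" where
  "ratfuns_in B = {Fract P Q | P Q. Q \<noteq> 0 \<and> vars P \<subseteq> B \<and> vars Q \<subseteq> B}"


section \<open>The higher Gel'fand-Dikii system\<close>

type_synonym 'a lattice_eq = "(site \<Rightarrow> 'a) \<Rightarrow> point \<Rightarrow> bool"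

definition gd_eq1 :: "'a::field \<Rightarrow> 'a \<Rightarrow> 'a \<Rightarrow> 'a lattice_eq" where
  "gd_eq1 p q \<omega> u = (\<lambda>(l, m).
     (p - q) * u (Tau, l, m) * u (Phi, l + 1, m + 1)
   + (q - \<omega>) * u (Tau, l, m + 1) * u (Phi, l + 1, m)
   + (\<omega> - p) * u (Tau, l + 1, m) * u (Phi, l, m + 1) = 0)"

definition gd_eq2 :: "'a::field \<Rightarrow> 'a \<Rightarrow> 'a \<Rightarrow> 'a lattice_eq" where
  "gd_eq2 p q \<omega> u = (\<lambda>(l, m).
     (p - q) * u (Tau, l + 1, m + 1) * u (Psi, l, m)
   + (q - \<omega>) * u (Tau, l + 1, m) * u (Psi, l, m + 1)
   + (\<omega> - p) * u (Tau, l, m + 1) * u (Psi, l + 1, m) = 0)"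

definition gd_eq3 :: "'a::field \<Rightarrow> 'a \<Rightarrow> 'a \<Rightarrow> 'a lattice_eq" where
  "gd_eq3 p q \<omega> u = (\<lambda>(l, m).
     (p - q) * u (Phi, l - 1, m) * u (Psi, l + 1, m + 1)
   + (q - \<omega>) * u (Phi, l - 1, m + 1) * u (Psi, l + 1, m)
   + (\<omega> - p) * u (Phi, l, m) * u (Psi, l, m + 1) = 0)"

definition gd_system :: "'a::field \<Rightarrow> 'a \<Rightarrow> 'a \<Rightarrow> 'a \<Rightarrow> 'a \<Rightarrow> 'a lattice_eq set" where
  "gd_system p q \<omega>1 \<omega>2 \<omega>3 = {gd_eq1 p q \<omega>1, gd_eq2 p q \<omega>2, gd_eq3 p q \<omega>3}"

definition solution :: "'a lattice_eq set \<Rightarrow> (site \<Rightarrow> 'a) \<Rightarrow> bool" where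
  "solution E u \<longleftrightarrow> (\<forall>e\<in>E. \<forall>y. e u y)"


section \<open>Squeezing a combined stencil\<close>

text \<open>The lines of direction \<open>s\<close> are the level sets of \<open>line_no s\<close>. The sign makes the
  level increase with the first coordinate, so that a line lies to the left of another iff its
  level is smaller; this is meant for \<open>s\<close> with \<open>snd s \<noteq> 0\<close> only.\<close>

definition line_no :: "point \<Rightarrow> point \<Rightarrow> int" where
  "line_no s x = sgn (snd s) * (snd s * fst x - fst s * snd x)"

text \<open>The two stencil points belonging to each variable.\<close>

type_synonym stencil = "dvar \<Rightarrow> point \<times> point"

definition left_line :: "point \<Rightarrow> stencil \<Rightarrow> dvar \<Rightarrow> int" where
  "left_line s St v = min (line_no s (fst (St v))) (line_no s (snd (St v)))"

definition right_line :: "point \<Rightarrow> stencil \<Rightarrow> dvar \<Rightarrow> int" where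
  "right_line s St v = max (line_no s (fst (St v))) (line_no s (snd (St v)))"

text \<open>The bands, widened by \<open>i\<close> levels to the left and by \<open>j\<close> levels to the right.\<close>

definition widened_bands :: "point \<Rightarrow> stencil \<Rightarrow> nat \<Rightarrow> nat \<Rightarrow> site set" where
  "widened_bands s St i j =
     {(v, x). left_line s St v - int i \<le> line_no s x \<and> line_no s x < right_line s St v + int j}"

definition squeeze :: "point \<Rightarrow> stencil \<Rightarrow> site set" where
  "squeeze s St = widened_bands s St 0 0"


section \<open>Well-posedness\<close>

text \<open>\<open>determines e y u K a\<close>: given the values of \<open>u\<close> on \<open>K\<close>, the equation \<open>e\<close> at the point \<open>y\<close>
  can be solved in only one way for the value at the site \<open>a\<close>.\<close>

definition determines :: "'a lattice_eq \<Rightarrow> point \<Rightarrow> (site \<Rightarrow> 'a) \<Rightarrow> site set \<Rightarrow> site \<Rightarrow> bool" where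
  "determines e y u K a \<longleftrightarrow> (\<forall>w. (\<forall>b\<in>K. w b = u b) \<longrightarrow> e w y \<longrightarrow> w a = u a)"

text \<open>The sites in \<open>T\<close> at which the values of the solution \<open>u\<close> are obtained from those on \<open>S\<close> by
  solving the equations one after another, without leaving \<open>T\<close>.\<close>

inductive_set solved_sites ::
  "'a lattice_eq set \<Rightarrow> (site \<Rightarrow> 'a) \<Rightarrow> site set \<Rightarrow> site set \<Rightarrow> site set"
  for E :: "'a lattice_eq set" and u :: "site \<Rightarrow> 'a" and T :: "site set" and S :: "site set"
where
  given: "a \<in> S \<Longrightarrow> a \<in> solved_sites E u T S"
| solve: "a \<in> T \<Longrightarrow> e \<in> E \<Longrightarrow> \<forall>b\<in>K. b \<in> solved_sites E u T S \<Longrightarrow> determines e y u K a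
    \<Longrightarrow> a \<in> solved_sites E u T S"

text \<open>The values are obtained line by line: the sites on the lines bounding the bands are solved
  for, the bands are widened by these lines, and so on, separately to the right and to the left.
  (Levels that carry no lattice point are harmless.)\<close>

definition solved_successively ::
  "'a lattice_eq set \<Rightarrow> point \<Rightarrow> stencil \<Rightarrow> (site \<Rightarrow> 'a) \<Rightarrow> bool" where
  "solved_successively E s St u \<longleftrightarrow>
     (\<forall>k. widened_bands s St 0 (Suc k)
        \<subseteq> solved_sites E u (widened_bands s St 0 (Suc k)) (widened_bands s St 0 k)) \<and>
     (\<forall>k. widened_bands s St (Suc k) 0
        \<subseteq> solved_sites E u (widened_bands s St (Suc k) 0) (widened_bands s St k 0))"

text \<open>Generic initial values are modelled by distinct indeterminates over the field \<open>'k\<close>.\<close>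

definition solves_ivp :: "'k::field ratfun lattice_eq set \<Rightarrow> site set \<Rightarrow> (site \<Rightarrow> 'k ratfun) \<Rightarrow> bool"
  where "solves_ivp E B u \<longleftrightarrow> solution E u \<and> (\<forall>a\<in>B. u a = indet a)"

definition well_posed :: "'k::field ratfun lattice_eq set \<Rightarrow> point \<Rightarrow> stencil \<Rightarrow> bool" where
  "well_posed E s St \<longleftrightarrow>
     (\<exists>u. solves_ivp E (squeeze s St) u \<and>
          (\<forall>u'. solves_ivp E (squeeze s St) u' \<longrightarrow> u' = u) \<and>
          range u \<subseteq> ratfuns_in (squeeze s St) \<and>
          solved_successively E s St u)"

end

theory Submission
  imports Defs
begin

text \<open>The coefficients of each of the three equations sum to zero, so the constant function 1
  is a solution. Outside the bands every site is matched with exactly one equation at one lattice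
  point, in such a way that the equation expresses the value at the site through values at sites
  nearer to the bands. Solving it involves a division, and the divisor is nonzero because
  every value obtained from the indeterminates specialises to 1 when all indeterminates are set
  to 1. The solution is then constructed by well-founded recursion along this matching.\<close>

section \<open>Rational functions with value 1 at the all-ones point\<close>

text \<open>This is evaluation at the point all of whose coordinates are 1.\<close>

definition eval_ones :: "'k::field site_poly \<Rightarrow> 'k" where
  "eval_ones P = (\<Sum>m \<in> Poly_Mapping.keys P. Poly_Mapping.lookup P m)"

text \<open>Allows one common index set for \<open>P\<close>, \<open>Q\<close> and
  \<open>P + Q\<close>, whose keys may differ because of cancellation.\<close>

lemma eval_ones_superset:
  assumes "finite A" "Poly_Mapping.keys P \<subseteq> A"
  shows "eval_ones P = (\<Sum>m \<in> A. Poly_Mapping.lookup P m)"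
  unfolding eval_ones_def using assms
  by (intro sum.mono_neutral_left) (auto simp: in_keys_iff)

lemma eval_ones_0 [simp]: "eval_ones 0 = 0"
  by (simp add: eval_ones_def)

lemma eval_ones_single [simp]: "eval_ones (Poly_Mapping.single m c) = c"
  by (simp add: eval_ones_def)

lemma eval_ones_add: "eval_ones (P + Q) = eval_ones P + eval_ones Q"
proof -
  let ?A = "Poly_Mapping.keys P \<union> Poly_Mapping.keys Q"
  have "eval_ones (P + Q) = (\<Sum>m \<in> ?A. Poly_Mapping.lookup (P + Q) m)"
    by (intro eval_ones_superset keys_add) auto
  also have "\<dots> = (\<Sum>m \<in> ?A. Poly_Mapping.lookup P m) + (\<Sum>m \<in> ?A. Poly_Mapping.lookup Q m)"
    by (simp add: lookup_add sum.distrib)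
  also have "\<dots> = eval_ones P + eval_ones Q"
    by (simp add: eval_ones_superset[of ?A])
  finally show ?thesis .
qed

lemma eval_ones_sum: "eval_ones (sum f A) = (\<Sum>i\<in>A. eval_ones (f i))"
  by (induction A rule: infinite_finite_induct) (simp_all add: eval_ones_add)

lemma sum_of_terms:
  fixes P :: "'k::field site_poly"
  shows "P = (\<Sum>m \<in> Poly_Mapping.keys P. Poly_Mapping.single m (Poly_Mapping.lookup P m))"
  by (rule poly_mapping_eqI)
    (auto simp: lookup_sum lookup_single when_def in_keys_iff sum.delta')

text \<open>Expand both factors into monomials: multiplying monomials multiplies their coefficients,
  and additivity of \<open>eval_ones\<close> does the rest.\<close>

lemma eval_ones_mult: "eval_ones (P * Q) = eval_ones P * eval_ones Q"
proof -
  have "P * Q = (\<Sum>m \<in> Poly_Mapping.keys P. \<Sum>n \<in> Poly_Mapping.keys Q.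
      Poly_Mapping.single (m + n) (Poly_Mapping.lookup P m * Poly_Mapping.lookup Q n))"
    by (subst sum_of_terms[of P], subst sum_of_terms[of Q]) (simp add: sum_product mult_single)
  then have "eval_ones (P * Q) = (\<Sum>m \<in> Poly_Mapping.keys P. \<Sum>n \<in> Poly_Mapping.keys Q.
      Poly_Mapping.lookup P m * Poly_Mapping.lookup Q n)"
    by (simp add: eval_ones_sum)
  then show ?thesis
    by (simp add: sum_product eval_ones_def)
qed

section \<open>Indeterminates occurring in sums and products\<close>

lemma vars_single_0 [simp]: "vars (Poly_Mapping.single 0 c) = {}"
  by (simp add: vars_def)

lemma vars_add: "vars (P + Q) \<subseteq> vars P \<union> vars Q"
  unfolding vars_def using keys_add[of P Q] by blast

lemma vars_mult: "vars (P * Q) \<subseteq> vars P \<union> vars Q"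
proof
  fix a assume "a \<in> vars (P * Q)"
  then obtain m n where "m \<in> Poly_Mapping.keys P" "n \<in> Poly_Mapping.keys Q"
      "a \<in> Poly_Mapping.keys (m + n)"
    unfolding vars_def using keys_mult[of P Q] by blast
  then show "a \<in> vars P \<union> vars Q"
    unfolding vars_def using keys_add[of m n] by blast
qed

text \<open>These are the principal units 1 + M of the local ring at the all-ones point, M its
  maximal ideal, with the sites of \<open>B\<close> as indeterminates. Keeping track of
  \<open>B\<close> yields membership in \<open>ratfuns_in B\<close> later.\<close>

definition one_at_ones :: "site set \<Rightarrow> 'k::field ratfun set" where
  "one_at_ones B = {Fract P Q | P Q. vars P \<subseteq> B \<and> vars Q \<subseteq> B \<and>
     eval_ones P = eval_ones Q \<and> eval_ones Q \<noteq> 0}"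

lemma one_at_onesI:
  "vars P \<subseteq> B \<Longrightarrow> vars Q \<subseteq> B \<Longrightarrow> eval_ones P = eval_ones Q \<Longrightarrow> eval_ones Q \<noteq> 0
    \<Longrightarrow> Fract P Q \<in> one_at_ones B"
  unfolding one_at_ones_def by blast

lemma one_at_onesE:
  assumes "x \<in> one_at_ones B"
  obtains P Q where "x = Fract P Q" "vars P \<subseteq> B" "vars Q \<subseteq> B"
    "eval_ones P = eval_ones Q" "eval_ones Q \<noteq> 0" "P \<noteq> 0" "Q \<noteq> 0"
  using assms unfolding one_at_ones_def by force

lemma one_at_ones_subset_ratfuns_in: "one_at_ones B \<subseteq> ratfuns_in B"
  by (auto elim!: one_at_onesE simp: ratfuns_in_def)

lemma one_at_ones_nonzero: "x \<in> one_at_ones B \<Longrightarrow> x \<noteq> 0"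
  by (auto elim!: one_at_onesE simp: Fract_conv_to_fract)

lemma indet_in_one_at_ones: "a \<in> B \<Longrightarrow> indet a \<in> one_at_ones B"
  \<comment> \<open>The denominator 1 in \<open>to_fract\<close> is turned into a constant monomial,
    so that the rules for \<open>single\<close> apply to it.\<close>
  unfolding indet_def to_fract_def by (intro one_at_onesI) (auto simp: vars_def simp flip: single_one)

lemma one_at_ones_mult:
  assumes "x \<in> one_at_ones B" "y \<in> one_at_ones B"
  shows "x * y \<in> one_at_ones B"
proof -
  obtain P Q P' Q' where *: "x = Fract P Q" "vars P \<subseteq> B" "vars Q \<subseteq> B"
      "eval_ones P = eval_ones Q" "eval_ones Q \<noteq> 0"
      "y = Fract P' Q'" "vars P' \<subseteq> B" "vars Q' \<subseteq> B"
      "eval_ones P' = eval_ones Q'" "eval_ones Q' \<noteq> 0"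
    using assms by (elim one_at_onesE)
  have "Fract (P * P') (Q * Q') \<in> one_at_ones B"
    using * vars_mult[of P P'] vars_mult[of Q Q']
    by (intro one_at_onesI) (auto simp: eval_ones_mult)
  with * show ?thesis by simp
qed

lemma one_at_ones_inverse:
  assumes "x \<in> one_at_ones B"
  shows "inverse x \<in> one_at_ones B"
  using assms by (auto elim!: one_at_onesE intro!: one_at_onesI)

lemma one_at_ones_divide:
  "x \<in> one_at_ones B \<Longrightarrow> y \<in> one_at_ones B \<Longrightarrow> x / y \<in> one_at_ones B"
  by (simp add: divide_inverse one_at_ones_mult one_at_ones_inverse)

section \<open>Constant coefficients and affine combinations\<close>

lemma const_diff: "const (a - b) = const a - const b"
  by (simp add: const_def single_diff)

lemma const_eq_0_iff [simp]: "const c = 0 \<longleftrightarrow> c = 0"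
  by (metis const_def eval_ones_single single_zero to_fract_eq_0_iff)

text \<open>The weights -b/a and -c/a sum to 1 because a + b + c = 0, and an affine combination of
  values equal to 1 is again 1. Here the vanishing coefficient sum of an equation enters.\<close>

lemma one_at_ones_combination:
  fixes a b c :: "'k::field"
  assumes "x \<in> one_at_ones B" "y \<in> one_at_ones B" "a \<noteq> 0" "a + b + c = 0"
  shows "- (const b * x + const c * y) / const a \<in> one_at_ones B"
proof -
  obtain P Q P' Q' where *: "x = Fract P Q" "vars P \<subseteq> B" "vars Q \<subseteq> B"
      "eval_ones P = eval_ones Q" "eval_ones Q \<noteq> 0" "Q \<noteq> 0"
      "y = Fract P' Q'" "vars P' \<subseteq> B" "vars Q' \<subseteq> B"
      "eval_ones P' = eval_ones Q'" "eval_ones Q' \<noteq> 0" "Q' \<noteq> 0"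
    using assms by (elim one_at_onesE)
  define C :: "'k \<Rightarrow> 'k site_poly" where "C = Poly_Mapping.single 0"
  have C: "eval_ones (C d) = d" "vars (C d) = {}" "const d = to_fract (C d)" for d
    by (simp_all add: C_def const_def)
  \<comment> \<open>\<open>N / D\<close> is the combination over the common denominator a Q Q'. Both
    \<open>N\<close> and \<open>D\<close> take the value a Q(1) Q'(1) at the all-ones point.\<close>
  define N where "N = C (- b) * (P * Q') + C (- c) * (P' * Q)"
  define D where "D = C a * (Q * Q')"
  have "a = - (b + c)"
    using assms(4) by (metis add.assoc eq_neg_iff_add_eq_0)
  then have a: "- b + - c = a" by simp
  have "eval_ones N = (- b + - c) * (eval_ones Q * eval_ones Q')"
    using * by (simp add: N_def eval_ones_add eval_ones_mult C algebra_simps)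
  also have "\<dots> = eval_ones D"
    using a by (simp add: D_def eval_ones_mult C)
  finally have "eval_ones N = eval_ones D" .
  moreover have "eval_ones D \<noteq> 0"
    using * assms(3) by (simp add: D_def eval_ones_mult C)
  moreover have "vars N \<subseteq> B"
    using * C vars_add[of "C (- b) * (P * Q')" "C (- c) * (P' * Q)"]
      vars_mult[of "C (- b)" "P * Q'"] vars_mult[of "C (- c)" "P' * Q"]
      vars_mult[of P Q'] vars_mult[of P' Q]
    unfolding N_def by blast
  moreover have "vars D \<subseteq> B"
    using * C vars_mult[of "C a" "Q * Q'"] vars_mult[of Q Q'] unfolding D_def by blast
  ultimately have "Fract N D \<in> one_at_ones B"
    by (intro one_at_onesI)
  also have "Fract N D = - (const b * x + const c * y) / const a"
  proof -
    have "const (- d) = - const d" for d :: 'k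
      using const_diff[of 0 d] by (metis const_eq_0_iff diff_0)
    moreover have "to_fract P = x * to_fract Q" "to_fract P' = y * to_fract Q'"
      using * by (simp_all add: Fract_conv_to_fract)
    ultimately show ?thesis
      using assms(3) \<open>Q \<noteq> 0\<close> \<open>Q' \<noteq> 0\<close>
      by (simp add: Fract_conv_to_fract N_def D_def C(3)[symmetric] field_simps)
  qed
  finally show ?thesis .
qed


section \<open>Triangular systems\<close>

text \<open>The equivalence serves both directions: from right to left it makes a recursively chosen
  value satisfy the equation, from left to right it gives uniqueness and \<open>determines\<close>.
  The set \<open>U\<close> is an invariant carried along the recursion to keep divisors
  nonzero.\<close>

definition solvable_in ::
  "'a set \<Rightarrow> 'a lattice_eq \<Rightarrow> point \<Rightarrow> site set \<Rightarrow> site \<Rightarrow> bool" where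
  "solvable_in U e y K a \<longleftrightarrow> (\<forall>w. (\<forall>b\<in>K. w b \<in> U) \<longrightarrow>
     (\<exists>x\<in>U. \<forall>w'. (\<forall>b\<in>K. w' b = w b) \<longrightarrow> (e w' y \<longleftrightarrow> w' a = x)))"

text \<open>The unknown \<open>w a\<close> occurs once, multiplied by
  \<open>const c0 * w a0\<close>. This factor is nonzero because principal units are, so the
  equation can be divided by it.\<close>

lemma solvable_in_one_at_ones:
  fixes c0 c1 c2 :: "'k::field"
  assumes "c0 \<noteq> 0" "c0 + c1 + c2 = 0" "{a0, b1, b2, b3, b4} \<subseteq> K"
    and e: "\<And>w. e w y \<longleftrightarrow> const c0 * w a0 * w a + const c1 * w b1 * w b2
      + const c2 * w b3 * w b4 = 0"
  shows "solvable_in (one_at_ones B) e y K a"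
  unfolding solvable_in_def
proof (intro allI impI)
  fix w :: "site \<Rightarrow> 'k ratfun" assume w: "\<forall>b\<in>K. w b \<in> one_at_ones B"
  \<comment> \<open>The divisor \<open>w a0\<close> is pushed into both quotients to obtain the
    shape of \<open>one_at_ones_combination\<close>.\<close>
  let ?x = "- (const c1 * (w b1 * w b2 / w a0) + const c2 * (w b3 * w b4 / w a0)) / const c0"
  have "?x \<in> one_at_ones B"
    using assms w
    by (intro one_at_ones_combination one_at_ones_divide one_at_ones_mult) auto
  moreover have "e w' y \<longleftrightarrow> w' a = ?x" if "\<forall>b\<in>K. w' b = w b" for w'
  proof -
    have nz: "w a0 \<noteq> 0" "const c0 \<noteq> 0"
      using one_at_ones_nonzero w assms by auto
    have w': "w' a0 = w a0" "w' b1 = w b1" "w' b2 = w b2" "w' b3 = w b3" "w' b4 = w b4"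
      using that assms by auto
    have x: "?x = - (const c1 * w b1 * w b2 + const c2 * w b3 * w b4) / (const c0 * w a0)"
      using nz by (simp add: field_simps)
    then have "w' a = ?x \<longleftrightarrow>
        w' a * (const c0 * w a0) = - (const c1 * w b1 * w b2 + const c2 * w b3 * w b4)"
      unfolding x using nz by (simp add: eq_divide_eq)
    also have "\<dots> \<longleftrightarrow> e w' y"
      unfolding e w' eq_neg_iff_add_eq_0 by (simp add: algebra_simps)
    finally show ?thesis by simp
  qed
  ultimately show "\<exists>x\<in>one_at_ones B. \<forall>w'. (\<forall>b\<in>K. w' b = w b) \<longrightarrow> (e w' y \<longleftrightarrow> w' a = x)"
    by blast
qed

text \<open>Well-founded recursion on \<open>rank\<close>: each site outside \<open>B\<close> gets
  the value forced by its own equation and the lower sites in \<open>K a\<close>. By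
  \<open>surj\<close> every equation at every point is the one of some site, so none is left
  unsatisfied. Uniqueness is an induction along the same order.\<close>

lemma triangular_solution:
  fixes rank :: "site \<Rightarrow> nat" and eqn :: "site \<Rightarrow> 'a lattice_eq" and pt :: "site \<Rightarrow> point"
  assumes init: "\<And>a. a \<in> B \<Longrightarrow> g a \<in> U"
    and eqn: "\<And>a. a \<notin> B \<Longrightarrow> eqn a \<in> E"
    and solv: "\<And>a. a \<notin> B \<Longrightarrow> solvable_in U (eqn a) (pt a) (K a) a"
    and rank: "\<And>a b. a \<notin> B \<Longrightarrow> b \<in> K a \<Longrightarrow> rank b < rank a"
    and surj: "\<And>e y. e \<in> E \<Longrightarrow> \<exists>a. a \<notin> B \<and> eqn a = e \<and> pt a = y"
  obtains u where "solution E u" "\<And>a. a \<in> B \<Longrightarrow> u a = g a" "range u \<subseteq> U"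
    "\<And>u'. solution E u' \<Longrightarrow> (\<And>a. a \<in> B \<Longrightarrow> u' a = g a) \<Longrightarrow> u' = u"
    "\<And>a. a \<notin> B \<Longrightarrow> determines (eqn a) (pt a) u (K a) a"
proof -
  define good where "good w a x \<longleftrightarrow> x \<in> U \<and> (\<forall>w'. (\<forall>b\<in>K a. w' b = w b) \<longrightarrow>
      (eqn a w' (pt a) \<longleftrightarrow> w' a = x))" for w a x
  define G where "G w a = (if a \<in> B then g a else SOME x. good w a x)" for w a
  define u where "u = wfrec (measure rank) G"
  have u: "u a = G u a" for a
  proof -
    \<comment> \<open>The recursion provides only values at lower rank. This loses nothing, since
      \<open>good\<close> inspects its first argument on \<open>K a\<close> alone.\<close>
    have "good (cut u (measure rank) a) a = good u a" if "a \<notin> B"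
      using rank[OF that] by (auto simp: good_def cut_def fun_eq_iff)
    then have "G (cut u (measure rank) a) a = G u a"
      by (simp add: G_def)
    then show ?thesis
      unfolding u_def by (subst wfrec) auto
  qed
  have uB: "u a = g a" if "a \<in> B" for a
    using u[of a] that by (simp add: G_def)
  \<comment> \<open>The choice by \<open>SOME\<close> is meaningful only once the values on
    \<open>K a\<close> are known to lie in \<open>U\<close>; the induction that follows discharges
    this premise.\<close>
  have step: "good u a (u a)" if "a \<notin> B" "\<forall>b\<in>K a. u b \<in> U" for a
  proof -
    have "\<exists>x. good u a x"
      using solv[OF that(1)] that(2) unfolding solvable_in_def good_def by blast
    then show ?thesis
      using u[of a] that(1) by (simp add: G_def someI_ex)
  qed
  have U: "u a \<in> U" for a
  proof (induction a rule: measure_induct_rule[of rank])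
    case (less a)
    show ?case
      using init[of a] uB[of a] step[of a] less rank[of a] by (cases "a \<in> B") (auto simp: good_def)
  qed
  have good: "good u a (u a)" if "a \<notin> B" for a
    using step that U by blast
  have "e u y" if "e \<in> E" for e y
    using surj[OF that, of y] good unfolding good_def by blast
  then have "solution E u"
    unfolding solution_def by blast
  moreover have "u' = u" if u': "solution E u'" "\<And>a. a \<in> B \<Longrightarrow> u' a = g a" for u'
  proof
    fix a
    show "u' a = u a"
    proof (induction a rule: measure_induct_rule[of rank])
      case (less a)
      show ?case
      proof (cases "a \<in> B")
        case False
        then have "\<forall>b\<in>K a. u' b = u b"
          using less rank by blast
        moreover have "eqn a u' (pt a)"
          using False u'(1) eqn unfolding solution_def by blast
        ultimately show ?thesis
          using good[OF False] unfolding good_def by blast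
      qed (simp add: uB u'(2))
    qed
  qed
  moreover have "determines (eqn a) (pt a) u (K a) a" if "a \<notin> B" for a
    using good[OF that] unfolding good_def determines_def by blast
  moreover have "range u \<subseteq> U" using U by blast
  ultimately show ?thesis using that uB by blast
qed


section \<open>Marching away from the bands\<close>

text \<open>The inequality is weak here and strict in \<open>left_of_band\<close>: the band contains
  its left line but not its right one.\<close>

definition right_of_band :: "point \<Rightarrow> stencil \<Rightarrow> site \<Rightarrow> bool" where
  "right_of_band s St a \<longleftrightarrow> right_line s St (fst a) \<le> line_no s (snd a)"

definition left_of_band :: "point \<Rightarrow> stencil \<Rightarrow> site \<Rightarrow> bool" where
  "left_of_band s St a \<longleftrightarrow> line_no s (snd a) < left_line s St (fst a)"

text \<open>The \<open>+ 1\<close> gives the excluded right line distance 1, like the first level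
  left of the left line. Inside the band \<open>nat\<close> truncates to 0, so distance at most k
  means lying in the bands widened by k on that side.\<close>

definition band_dist :: "point \<Rightarrow> stencil \<Rightarrow> site \<Rightarrow> nat" where
  "band_dist s St a =
     (if right_of_band s St a then nat (line_no s (snd a) - right_line s St (fst a) + 1)
      else nat (left_line s St (fst a) - line_no s (snd a)))"

text \<open>On lines at the same distance from the bands, the variables are solved for in the order
  \<open>\<phi>, \<psi>, \<tau>\<close> on the right and \<open>\<psi>, \<phi>, \<tau>\<close> on the left.\<close>

definition prio :: "bool \<Rightarrow> dvar \<Rightarrow> nat" where
  "prio right v = (case v of Tau \<Rightarrow> 2 | Phi \<Rightarrow> if right then 0 else 1
     | Psi \<Rightarrow> if right then 1 else 0)"

text \<open>Encodes the lexicographic order of distance and priority; the factor 3 works because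
  priorities are at most 2.\<close>

definition rank :: "point \<Rightarrow> stencil \<Rightarrow> site \<Rightarrow> nat" where
  "rank s St a = 3 * band_dist s St a + prio (right_of_band s St a) (fst a)"

text \<open>The condition on sides confines each march to bands widened in one direction only, as
  \<open>solved_successively\<close> demands; a low rank alone would admit sites on the opposite
  side.\<close>

definition known :: "point \<Rightarrow> stencil \<Rightarrow> site \<Rightarrow> site set" where
  "known s St a = {b. rank s St b < rank s St a \<and>
     (if right_of_band s St a then \<not> left_of_band s St b else \<not> right_of_band s St b)}"

lemma prio_le_2: "prio r v \<le> 2"
  by (cases v) (simp_all add: prio_def)

lemma band_dist_le_if_rank_less: "rank s St b < rank s St a \<Longrightarrow> band_dist s St b \<le> band_dist s St a"
  using prio_le_2[of "right_of_band s St a" "fst a"] by (simp add: rank_def)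

text \<open>Reduces membership to linear inequalities between levels. If \<open>z\<close> lies
  inside its band, its rank is at most 2, whereas \<open>x\<close> has rank at least 3; in a tie
  both sites are right of their bands, so \<open>prio True\<close> decides.\<close>

lemma known_rightI:
  assumes "right_line s St v \<le> line_no s x" "left_line s St w \<le> line_no s z"
    and "line_no s z - right_line s St w < line_no s x - right_line s St v \<or>
      line_no s z - right_line s St w = line_no s x - right_line s St v \<and> prio True w < prio True v"
  shows "(w, z) \<in> known s St (v, x)"
  using assms prio_le_2[of False w] prio_le_2[of True w]
  by (auto simp: known_def rank_def band_dist_def right_of_band_def left_of_band_def)

lemma known_leftI:
  assumes "left_line s St v \<le> right_line s St v"
    and "line_no s x < left_line s St v" "line_no s z < right_line s St w"
    and "left_line s St w - line_no s z < left_line s St v - line_no s x \<or>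
      left_line s St w - line_no s z = left_line s St v - line_no s x \<and> prio False w < prio False v"
  shows "(w, z) \<in> known s St (v, x)"
  using assms prio_le_2[of False w] prio_le_2[of True w]
  by (auto simp: known_def rank_def band_dist_def right_of_band_def left_of_band_def)

lemma widened_bands_right_iff:
  "a \<in> widened_bands s St 0 k \<longleftrightarrow> \<not> left_of_band s St a \<and> band_dist s St a \<le> k"
  by (cases a) (auto simp: widened_bands_def left_of_band_def right_of_band_def band_dist_def)

lemma left_line_le_right_line: "left_line s St v \<le> right_line s St v"
  by (simp add: left_line_def right_line_def)

lemma widened_bands_left_iff:
  "a \<in> widened_bands s St k 0 \<longleftrightarrow> \<not> right_of_band s St a \<and> band_dist s St a \<le> k"
  using left_line_le_right_line[of s St "fst a"]
  by (cases a) (auto simp: widened_bands_def left_of_band_def right_of_band_def band_dist_def)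

lemma squeeze_iff: "a \<in> squeeze s St \<longleftrightarrow> \<not> left_of_band s St a \<and> \<not> right_of_band s St a"
  by (cases a) (auto simp: squeeze_def widened_bands_def left_of_band_def right_of_band_def)

lemma not_left_and_right: "left_of_band s St a \<Longrightarrow> \<not> right_of_band s St a"
  using left_line_le_right_line[of s St "fst a"] by (simp add: left_of_band_def right_of_band_def)

text \<open>Induction on the rank inside one widened band: the sites in \<open>known\<close> are no
  farther out and not on the opposite side, so they stay in that band. Only sites of the original
  bands are taken as given; all added lines are solved.\<close>

lemma solved_successivelyI:
  assumes "\<And>a. a \<notin> squeeze s St \<Longrightarrow> eqn a \<in> E"
    and "\<And>a. a \<notin> squeeze s St \<Longrightarrow> determines (eqn a) (pt a) u (known s St a) a"
  shows "solved_successively E s St u"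
  unfolding solved_successively_def
proof (intro conjI allI subsetI)
  fix k a
  let ?T = "widened_bands s St 0 (Suc k)" and ?S = "widened_bands s St 0 k"
  assume "a \<in> ?T"
  then show "a \<in> solved_sites E u ?T ?S"
  proof (induction a rule: measure_induct_rule[of "rank s St"])
    case (less a)
    show ?case
    proof (cases "right_of_band s St a")
      case True
      then have a: "a \<notin> squeeze s St" by (simp add: squeeze_iff)
      have "b \<in> solved_sites E u ?T ?S" if "b \<in> known s St a" for b
        using that True less band_dist_le_if_rank_less[of s St b a]
        by (auto simp: known_def widened_bands_right_iff)
      then show ?thesis
        using solved_sites.solve[OF less.prems assms(1)[OF a] _ assms(2)[OF a]] by blast
    next
      case False
      then show ?thesis
        using less.prems
        by (intro solved_sites.given)
          (simp add: widened_bands_right_iff band_dist_def left_of_band_def)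
    qed
  qed
next
  fix k a
  let ?T = "widened_bands s St (Suc k) 0" and ?S = "widened_bands s St k 0"
  assume "a \<in> ?T"
  then show "a \<in> solved_sites E u ?T ?S"
  proof (induction a rule: measure_induct_rule[of "rank s St"])
    case (less a)
    show ?case
    proof (cases "left_of_band s St a")
      case True
      then have a: "a \<notin> squeeze s St" by (simp add: squeeze_iff)
      have "b \<in> solved_sites E u ?T ?S" if "b \<in> known s St a" for b
        using that not_left_and_right[OF True] less band_dist_le_if_rank_less[of s St b a]
        by (auto simp: known_def widened_bands_left_iff)
      then show ?thesis
        using solved_sites.solve[OF less.prems assms(1)[OF a] _ assms(2)[OF a]] by blast
    next
      case False
      then show ?thesis
        using less.prems
        by (intro solved_sites.given)
          (simp add: widened_bands_left_iff band_dist_def left_of_band_def)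
    qed
  qed
qed

text \<open>Leaves only the matching of sites with equations to be checked. The set
  \<open>one_at_ones\<close> is both the invariant that permits division and the proof that values
  are rational in the initial data.\<close>

lemma well_posed_if_triangular:
  fixes E :: "'k::field ratfun lattice_eq set"
  assumes eqn: "\<And>a. a \<notin> squeeze s St \<Longrightarrow> eqn a \<in> E"
    and solv: "\<And>a. a \<notin> squeeze s St \<Longrightarrow>
      solvable_in (one_at_ones (squeeze s St)) (eqn a) (pt a) (known s St a) a"
    and surj: "\<And>e y. e \<in> E \<Longrightarrow> \<exists>a. a \<notin> squeeze s St \<and> eqn a = e \<and> pt a = y"
  shows "well_posed E s St"
proof -
  obtain u where u: "solution E u" "\<And>a. a \<in> squeeze s St \<Longrightarrow> u a = indet a"
      "range u \<subseteq> one_at_ones (squeeze s St)"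
      "\<And>u'. solution E u' \<Longrightarrow> (\<And>a. a \<in> squeeze s St \<Longrightarrow> u' a = indet a) \<Longrightarrow> u' = u"
      "\<And>a. a \<notin> squeeze s St \<Longrightarrow> determines (eqn a) (pt a) u (known s St a) a"
  proof (rule triangular_solution[of "squeeze s St" indet "one_at_ones (squeeze s St)" eqn E pt
        "known s St" "rank s St"])
    show "rank s St b < rank s St a" if "b \<in> known s St a" for a b
      using that by (simp add: known_def)
  qed (use eqn solv surj indet_in_one_at_ones in blast)+
  have "solved_successively E s St u"
    using eqn u(5) by (rule solved_successivelyI)
  then show ?thesis
    using u(1-4) one_at_ones_subset_ratfuns_in unfolding well_posed_def solves_ivp_def by blast
qed

section \<open>The two initial value problems\<close>

text \<open>Levels grow with l and fall with m, so in each equation the term with coefficient q -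
  \<omega>_i has one factor on the rightmost and one on the leftmost level. Marching right solves
  for the former, marching left for the latter.\<close>

lemma well_posed_positive_slope:
  fixes p q \<omega>1 \<omega>2 \<omega>3 :: "'k::field"
  assumes coeffs: "q - \<omega>1 \<noteq> 0" "q - \<omega>2 \<noteq> 0" "q - \<omega>3 \<noteq> 0"
    and St: "St Tau = ((0, 1), (2, 0))" "St Phi = ((0, 1), (1, 0))" "St Psi = ((1, 1), (2, 0))"
    and s1: "s1 > 0" and s2: "s2 > 0"
  shows "well_posed (gd_system (const p) (const q) (const \<omega>1) (const \<omega>2) (const \<omega>3))
    (s1, s2) St"
proof -
  let ?s = "(s1, s2)"
  define eqn1 where "eqn1 = gd_eq1 (const p) (const q) (const \<omega>1)"
  define eqn2 where "eqn2 = gd_eq2 (const p) (const q) (const \<omega>2)"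
  define eqn3 where "eqn3 = gd_eq3 (const p) (const q) (const \<omega>3)"
  define eqn where "eqn a = (case fst a of
      Tau \<Rightarrow> if right_of_band ?s St a then eqn2 else eqn1
    | Phi \<Rightarrow> if right_of_band ?s St a then eqn1 else eqn3
    | Psi \<Rightarrow> if right_of_band ?s St a then eqn3 else eqn2)" for a
  \<comment> \<open>Inverts the offset of the solved site in its equation: (1,0) on the right; (0,1)
    on the left, except (-1,1) for \<open>Phi\<close>, whose indices in the third equation are
    shifted.\<close>
  define pt where "pt a = (case a of (v, l, m) \<Rightarrow>
      if right_of_band ?s St a then (l - 1, m)
      else case v of Tau \<Rightarrow> (l, m - 1) | Phi \<Rightarrow> (l + 1, m - 1) | Psi \<Rightarrow> (l, m - 1))" for a
  have line_no: "line_no ?s (l, m) = s2 * l - s1 * m" for l m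
    using s2 by (simp add: line_no_def)
  have lines: "left_line ?s St Tau = - s1" "right_line ?s St Tau = 2 * s2"
      "left_line ?s St Phi = - s1" "right_line ?s St Phi = s2"
      "left_line ?s St Psi = s2 - s1" "right_line ?s St Psi = 2 * s2"
    using s1 s2 by (simp_all add: left_line_def right_line_def St line_no)
  note bands = line_no lines
  show ?thesis
  proof (rule well_posed_if_triangular[of ?s St eqn _ pt])
    show "eqn a \<in> gd_system (const p) (const q) (const \<omega>1) (const \<omega>2) (const \<omega>3)" for a
      by (cases "fst a") (simp_all add: eqn_def gd_system_def eqn1_def eqn2_def eqn3_def)
  next
    fix a assume a_out: "a \<notin> squeeze ?s St"
    obtain v l m where a: "a = (v, l, m)" by (cases a)
    show "solvable_in (one_at_ones (squeeze ?s St)) (eqn a) (pt a) (known ?s St a) a"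
    proof (cases "right_of_band ?s St a")
      case True
      then have right: "right_line ?s St v \<le> line_no ?s (l, m)"
        by (simp add: right_of_band_def a)
      have pt: "pt a = (l - 1, m)"
        using True by (simp add: pt_def a)
      show ?thesis
      proof (cases v)
        case Tau
        have eqn: "eqn a = eqn2"
          using True by (simp add: eqn_def a Tau)
        \<comment> \<open>The first site is the partner of the unknown, the others are the factors
          of the remaining two terms in order. The site \<open>(Psi, l, m)\<close> is at the same
          distance as the unknown, so the priorities decide.\<close>
        have "{(Psi, l - 1, m + 1), (Tau, l, m + 1), (Psi, l - 1, m),
            (Tau, l - 1, m + 1), (Psi, l, m)} \<subseteq> known ?s St a"
          using right s1 s2 unfolding a Tau insert_subset
          by (intro conjI known_rightI empty_subsetI left_line_le_right_line)
            (simp_all add: bands prio_def algebra_simps)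
        then show ?thesis
          unfolding eqn pt
          \<comment> \<open>\<open>rotated 2\<close> puts the inclusion first, so that it fixes the
            roles of the five sites.\<close>
          by (rule solvable_in_one_at_ones[where ?c0.0 = "q - \<omega>2" and ?c1.0 = "p - q"
                and ?c2.0 = "\<omega>2 - p", rotated 2])
            (use coeffs in \<open>simp_all add: eqn2_def gd_eq2_def const_diff a Tau ac_simps\<close>)
      next
        case Phi
        have eqn: "eqn a = eqn1"
          using True by (simp add: eqn_def a Phi)
        have "{(Tau, l - 1, m + 1), (Tau, l - 1, m), (Phi, l, m + 1),
            (Tau, l, m), (Phi, l - 1, m + 1)} \<subseteq> known ?s St a"
          using right s1 s2 unfolding a Phi insert_subset
          by (intro conjI known_rightI empty_subsetI left_line_le_right_line)
            (simp_all add: bands prio_def algebra_simps)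
        then show ?thesis
          unfolding eqn pt
          by (rule solvable_in_one_at_ones[where ?c0.0 = "q - \<omega>1" and ?c1.0 = "p - q"
                and ?c2.0 = "\<omega>1 - p", rotated 2])
            (use coeffs in \<open>simp_all add: eqn1_def gd_eq1_def const_diff a Phi ac_simps\<close>)
      next
        case Psi
        have eqn: "eqn a = eqn3"
          using True by (simp add: eqn_def a Psi)
        have "{(Phi, l - 2, m + 1), (Phi, l - 2, m), (Psi, l, m + 1),
            (Phi, l - 1, m), (Psi, l - 1, m + 1)} \<subseteq> known ?s St a"
          using right s1 s2 unfolding a Psi insert_subset
          by (intro conjI known_rightI empty_subsetI left_line_le_right_line)
            (simp_all add: bands prio_def algebra_simps)
        then show ?thesis
          unfolding eqn pt
          by (rule solvable_in_one_at_ones[where ?c0.0 = "q - \<omega>3" and ?c1.0 = "p - q"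
                and ?c2.0 = "\<omega>3 - p", rotated 2])
            (use coeffs in \<open>simp_all add: eqn3_def gd_eq3_def const_diff a Psi ac_simps\<close>)
      qed
    next
      case not_right: False
      then have left: "line_no ?s (l, m) < left_line ?s St v"
        using a_out by (simp add: squeeze_iff left_of_band_def a)
      have pt: "pt a = (case v of Tau \<Rightarrow> (l, m - 1) | Phi \<Rightarrow> (l + 1, m - 1) | Psi \<Rightarrow> (l, m - 1))"
        using not_right by (simp add: pt_def a)
      show ?thesis
      proof (cases v)
        case Tau
        have eqn: "eqn a = eqn1"
          using not_right by (simp add: eqn_def a Tau)
        \<comment> \<open>Here \<open>(Phi, l, m)\<close> ties with the unknown, whence
          \<open>Phi\<close> precedes \<open>Tau\<close> on the left as well.\<close>
        have "{(Phi, l + 1, m - 1), (Tau, l, m - 1), (Phi, l + 1, m),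
            (Tau, l + 1, m - 1), (Phi, l, m)} \<subseteq> known ?s St a"
          using left s1 s2 unfolding a Tau insert_subset
          by (intro conjI known_leftI empty_subsetI left_line_le_right_line)
            (simp_all add: bands prio_def algebra_simps)
        then show ?thesis
          unfolding eqn pt[unfolded Tau, simplified]
          by (rule solvable_in_one_at_ones[where ?c0.0 = "q - \<omega>1" and ?c1.0 = "p - q"
                and ?c2.0 = "\<omega>1 - p", rotated 2])
            (use coeffs in \<open>simp_all add: eqn1_def gd_eq1_def const_diff a Tau ac_simps\<close>)
      next
        case Phi
        have eqn: "eqn a = eqn3"
          using not_right by (simp add: eqn_def a Phi)
        have "{(Psi, l + 2, m - 1), (Phi, l, m - 1), (Psi, l + 2, m),
            (Phi, l + 1, m - 1), (Psi, l + 1, m)} \<subseteq> known ?s St a"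
          using left s1 s2 unfolding a Phi insert_subset
          by (intro conjI known_leftI empty_subsetI left_line_le_right_line)
            (simp_all add: bands prio_def algebra_simps)
        then show ?thesis
          unfolding eqn pt[unfolded Phi, simplified]
          by (rule solvable_in_one_at_ones[where ?c0.0 = "q - \<omega>3" and ?c1.0 = "p - q"
                and ?c2.0 = "\<omega>3 - p", rotated 2])
            (use coeffs in \<open>simp_all add: eqn3_def gd_eq3_def const_diff a Phi ac_simps\<close>)
      next
        case Psi
        have eqn: "eqn a = eqn2"
          using not_right by (simp add: eqn_def a Psi)
        have "{(Tau, l + 1, m - 1), (Tau, l + 1, m), (Psi, l, m - 1),
            (Tau, l, m), (Psi, l + 1, m - 1)} \<subseteq> known ?s St a"
          using left s1 s2 unfolding a Psi insert_subset
          by (intro conjI known_leftI empty_subsetI left_line_le_right_line)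
            (simp_all add: bands prio_def algebra_simps)
        then show ?thesis
          unfolding eqn pt[unfolded Psi, simplified]
          by (rule solvable_in_one_at_ones[where ?c0.0 = "q - \<omega>2" and ?c1.0 = "p - q"
                and ?c2.0 = "\<omega>2 - p", rotated 2])
            (use coeffs in \<open>simp_all add: eqn2_def gd_eq2_def const_diff a Psi ac_simps\<close>)
      qed
    qed
  next
    fix e and y :: point
    assume "e \<in> gd_system (const p) (const q) (const \<omega>1) (const \<omega>2) (const \<omega>3)"
    then consider "e = eqn1" | "e = eqn2" | "e = eqn3"
      by (auto simp: gd_system_def eqn1_def eqn2_def eqn3_def)
    moreover obtain l m where y: "y = (l, m)" by (cases y)
    ultimately show "\<exists>a. a \<notin> squeeze ?s St \<and> eqn a = e \<and> pt a = y"
    proof cases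
      case 1
      \<comment> \<open>The two candidates are the factors of the q - \<omega>1 term. With n the
        level of \<open>y\<close>, \<open>Phi\<close> is right of its band iff n + s2 \<ge> s2, and
        \<open>Tau\<close> left of its band iff n - s1 < - s1, so the threshold 0 separates them.
        The other two equations have threshold s2.\<close>
      show ?thesis
        by (rule exI[of _ "if line_no ?s y \<ge> 0 then (Phi, l + 1, m) else (Tau, l, m + 1)"])
          (use 1 s1 s2 in \<open>simp add: y squeeze_iff right_of_band_def left_of_band_def eqn_def pt_def
            bands algebra_simps\<close>)
    next
      case 2
      show ?thesis
        by (rule exI[of _ "if line_no ?s y \<ge> s2 then (Tau, l + 1, m) else (Psi, l, m + 1)"])
          (use 2 s1 s2 in \<open>simp add: y squeeze_iff right_of_band_def left_of_band_def eqn_def pt_def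
            bands algebra_simps\<close>)
    next
      case 3
      show ?thesis
        by (rule exI[of _ "if line_no ?s y \<ge> s2 then (Psi, l + 1, m) else (Phi, l - 1, m + 1)"])
          (use 3 s1 s2 in \<open>simp add: y squeeze_iff right_of_band_def left_of_band_def eqn_def pt_def
            bands algebra_simps\<close>)
    qed
  qed
qed

text \<open>Now levels grow with both l and m, and the term with coefficient p - q holds the factors
  on the extreme levels. Every site used is strictly nearer to its band than the unknown, or inside
  it, so no ties arise.\<close>

lemma well_posed_negative_slope:
  fixes p q \<omega>1 \<omega>2 \<omega>3 :: "'k::field"
  assumes coeffs: "p - q \<noteq> 0"
    and St: "St Tau = ((0, 0), (2, 1))" "St Phi = ((0, 0), (1, 1))" "St Psi = ((1, 0), (2, 1))"
    and s1: "s1 > 0" and s2: "s2 < 0"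
  shows "well_posed (gd_system (const p) (const q) (const \<omega>1) (const \<omega>2) (const \<omega>3))
    (s1, s2) St"
proof -
  let ?s = "(s1, s2)"
  define eqn1 where "eqn1 = gd_eq1 (const p) (const q) (const \<omega>1)"
  define eqn2 where "eqn2 = gd_eq2 (const p) (const q) (const \<omega>2)"
  define eqn3 where "eqn3 = gd_eq3 (const p) (const q) (const \<omega>3)"
  define eqn where "eqn a = (case fst a of
      Tau \<Rightarrow> if right_of_band ?s St a then eqn2 else eqn1
    | Phi \<Rightarrow> if right_of_band ?s St a then eqn1 else eqn3
    | Psi \<Rightarrow> if right_of_band ?s St a then eqn3 else eqn2)" for a
  define pt where "pt a = (case a of (v, l, m) \<Rightarrow>
      if right_of_band ?s St a then (l - 1, m - 1)
      else case v of Tau \<Rightarrow> (l, m) | Phi \<Rightarrow> (l + 1, m) | Psi \<Rightarrow> (l, m))" for a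
  \<comment> \<open>The sign of \<open>s2\<close> in \<open>line_no\<close> reverses the
    orientation.\<close>
  have line_no: "line_no ?s (l, m) = - s2 * l + s1 * m" for l m
    using s2 by (simp add: line_no_def)
  have lines: "left_line ?s St Tau = 0" "right_line ?s St Tau = s1 - 2 * s2"
      "left_line ?s St Phi = 0" "right_line ?s St Phi = s1 - s2"
      "left_line ?s St Psi = - s2" "right_line ?s St Psi = s1 - 2 * s2"
    using s1 s2 by (simp_all add: left_line_def right_line_def St line_no)
  note bands = line_no lines
  show ?thesis
  proof (rule well_posed_if_triangular[of ?s St eqn _ pt])
    show "eqn a \<in> gd_system (const p) (const q) (const \<omega>1) (const \<omega>2) (const \<omega>3)" for a
      by (cases "fst a") (simp_all add: eqn_def gd_system_def eqn1_def eqn2_def eqn3_def)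
  next
    fix a assume a_out: "a \<notin> squeeze ?s St"
    obtain v l m where a: "a = (v, l, m)" by (cases a)
    show "solvable_in (one_at_ones (squeeze ?s St)) (eqn a) (pt a) (known ?s St a) a"
    proof (cases "right_of_band ?s St a")
      case True
      then have right: "right_line ?s St v \<le> line_no ?s (l, m)"
        by (simp add: right_of_band_def a)
      have pt: "pt a = (l - 1, m - 1)"
        using True by (simp add: pt_def a)
      show ?thesis
      proof (cases v)
        case Tau
        have eqn: "eqn a = eqn2"
          using True by (simp add: eqn_def a Tau)
        have "{(Psi, l - 1, m - 1), (Tau, l, m - 1), (Psi, l - 1, m),
            (Tau, l - 1, m), (Psi, l, m - 1)} \<subseteq> known ?s St a"
          using right s1 s2 unfolding a Tau insert_subset
          by (intro conjI known_rightI empty_subsetI left_line_le_right_line)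
            (simp_all add: bands prio_def algebra_simps)
        then show ?thesis
          unfolding eqn pt
          by (rule solvable_in_one_at_ones[where ?c0.0 = "p - q" and ?c1.0 = "q - \<omega>2"
                and ?c2.0 = "\<omega>2 - p", rotated 2])
            (use coeffs in \<open>simp_all add: eqn2_def gd_eq2_def const_diff a Tau ac_simps\<close>)
      next
        case Phi
        have eqn: "eqn a = eqn1"
          using True by (simp add: eqn_def a Phi)
        have "{(Tau, l - 1, m - 1), (Tau, l - 1, m), (Phi, l, m - 1),
            (Tau, l, m - 1), (Phi, l - 1, m)} \<subseteq> known ?s St a"
          using right s1 s2 unfolding a Phi insert_subset
          by (intro conjI known_rightI empty_subsetI left_line_le_right_line)
            (simp_all add: bands prio_def algebra_simps)
        then show ?thesis
          unfolding eqn pt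
          by (rule solvable_in_one_at_ones[where ?c0.0 = "p - q" and ?c1.0 = "q - \<omega>1"
                and ?c2.0 = "\<omega>1 - p", rotated 2])
            (use coeffs in \<open>simp_all add: eqn1_def gd_eq1_def const_diff a Phi ac_simps\<close>)
      next
        case Psi
        have eqn: "eqn a = eqn3"
          using True by (simp add: eqn_def a Psi)
        have "{(Phi, l - 2, m - 1), (Phi, l - 2, m), (Psi, l, m - 1),
            (Phi, l - 1, m - 1), (Psi, l - 1, m)} \<subseteq> known ?s St a"
          using right s1 s2 unfolding a Psi insert_subset
          by (intro conjI known_rightI empty_subsetI left_line_le_right_line)
            (simp_all add: bands prio_def algebra_simps)
        then show ?thesis
          unfolding eqn pt
          by (rule solvable_in_one_at_ones[where ?c0.0 = "p - q" and ?c1.0 = "q - \<omega>3"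
                and ?c2.0 = "\<omega>3 - p", rotated 2])
            (use coeffs in \<open>simp_all add: eqn3_def gd_eq3_def const_diff a Psi ac_simps\<close>)
      qed
    next
      case not_right: False
      then have left: "line_no ?s (l, m) < left_line ?s St v"
        using a_out by (simp add: squeeze_iff left_of_band_def a)
      have pt: "pt a = (case v of Tau \<Rightarrow> (l, m) | Phi \<Rightarrow> (l + 1, m) | Psi \<Rightarrow> (l, m))"
        using not_right by (simp add: pt_def a)
      show ?thesis
      proof (cases v)
        case Tau
        have eqn: "eqn a = eqn1"
          using not_right by (simp add: eqn_def a Tau)
        have "{(Phi, l + 1, m + 1), (Tau, l, m + 1), (Phi, l + 1, m),
            (Tau, l + 1, m), (Phi, l, m + 1)} \<subseteq> known ?s St a"
          using left s1 s2 unfolding a Tau insert_subset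
          by (intro conjI known_leftI empty_subsetI left_line_le_right_line)
            (simp_all add: bands prio_def algebra_simps)
        then show ?thesis
          unfolding eqn pt[unfolded Tau, simplified]
          by (rule solvable_in_one_at_ones[where ?c0.0 = "p - q" and ?c1.0 = "q - \<omega>1"
                and ?c2.0 = "\<omega>1 - p", rotated 2])
            (use coeffs in \<open>simp_all add: eqn1_def gd_eq1_def const_diff a Tau ac_simps\<close>)
      next
        case Phi
        have eqn: "eqn a = eqn3"
          using not_right by (simp add: eqn_def a Phi)
        have "{(Psi, l + 2, m + 1), (Phi, l, m + 1), (Psi, l + 2, m),
            (Phi, l + 1, m), (Psi, l + 1, m + 1)} \<subseteq> known ?s St a"
          using left s1 s2 unfolding a Phi insert_subset
          by (intro conjI known_leftI empty_subsetI left_line_le_right_line)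
            (simp_all add: bands prio_def algebra_simps)
        then show ?thesis
          unfolding eqn pt[unfolded Phi, simplified]
          by (rule solvable_in_one_at_ones[where ?c0.0 = "p - q" and ?c1.0 = "q - \<omega>3"
                and ?c2.0 = "\<omega>3 - p", rotated 2])
            (use coeffs in \<open>simp_all add: eqn3_def gd_eq3_def const_diff a Phi ac_simps\<close>)
      next
        case Psi
        have eqn: "eqn a = eqn2"
          using not_right by (simp add: eqn_def a Psi)
        have "{(Tau, l + 1, m + 1), (Tau, l + 1, m), (Psi, l, m + 1),
            (Tau, l, m + 1), (Psi, l + 1, m)} \<subseteq> known ?s St a"
          using left s1 s2 unfolding a Psi insert_subset
          by (intro conjI known_leftI empty_subsetI left_line_le_right_line)
            (simp_all add: bands prio_def algebra_simps)
        then show ?thesis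
          unfolding eqn pt[unfolded Psi, simplified]
          by (rule solvable_in_one_at_ones[where ?c0.0 = "p - q" and ?c1.0 = "q - \<omega>2"
                and ?c2.0 = "\<omega>2 - p", rotated 2])
            (use coeffs in \<open>simp_all add: eqn2_def gd_eq2_def const_diff a Psi ac_simps\<close>)
      qed
    qed
  next
    fix e and y :: point
    assume "e \<in> gd_system (const p) (const q) (const \<omega>1) (const \<omega>2) (const \<omega>3)"
    then consider "e = eqn1" | "e = eqn2" | "e = eqn3"
      by (auto simp: gd_system_def eqn1_def eqn2_def eqn3_def)
    moreover obtain l m where y: "y = (l, m)" by (cases y)
    ultimately show "\<exists>a. a \<notin> squeeze ?s St \<and> eqn a = e \<and> pt a = y"
    proof cases
      case 1
      \<comment> \<open>As for positive slope, one threshold on the level of \<open>y\<close>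
        decides which extreme factor lies outside its band: 0 for the first equation, - s2 for the
        others.\<close>
      show ?thesis
        by (rule exI[of _ "if line_no ?s y \<ge> 0 then (Phi, l + 1, m + 1) else (Tau, l, m)"])
          (use 1 s1 s2 in \<open>simp add: y squeeze_iff right_of_band_def left_of_band_def eqn_def pt_def
            bands algebra_simps\<close>)
    next
      case 2
      show ?thesis
        by (rule exI[of _ "if line_no ?s y \<ge> - s2 then (Tau, l + 1, m + 1) else (Psi, l, m)"])
          (use 2 s1 s2 in \<open>simp add: y squeeze_iff right_of_band_def left_of_band_def eqn_def pt_def
            bands algebra_simps\<close>)
    next
      case 3
      show ?thesis
        by (rule exI[of _ "if line_no ?s y \<ge> - s2 then (Psi, l + 1, m + 1) else (Phi, l - 1, m)"])
          (use 3 s1 s2 in \<open>simp add: y squeeze_iff right_of_band_def left_of_band_def eqn_def pt_def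
            bands algebra_simps\<close>)
    qed
  qed
qed

theorem proposition3:
  fixes p q \<omega>1 \<omega>2 \<omega>3 :: "'k::field"
  assumes "p - q \<noteq> 0"
    and "q - \<omega>1 \<noteq> 0" and "q - \<omega>2 \<noteq> 0" and "q - \<omega>3 \<noteq> 0"
    and "\<omega>1 - p \<noteq> 0" and "\<omega>2 - p \<noteq> 0" and "\<omega>3 - p \<noteq> 0"
  defines "GD \<equiv> gd_system (const p) (const q) (const \<omega>1) (const \<omega>2) (const \<omega>3)"
    and "Sa \<equiv> (\<lambda>v. case v of
            Tau \<Rightarrow> ((0, 1), (2, 0)) | Phi \<Rightarrow> ((0, 1), (1, 0)) | Psi \<Rightarrow> ((1, 1), (2, 0)))"
    and "Sb \<equiv> (\<lambda>v. case v of
            Tau \<Rightarrow> ((0, 0), (2, 1)) | Phi \<Rightarrow> ((0, 0), (1, 1)) | Psi \<Rightarrow> ((1, 0), (2, 1)))"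
  shows
    "(\<forall>s1 s2. s1 > 0 \<and> s2 > 0 \<longrightarrow>
        well_posed GD (s1, s2) Sa \<and>
        squeeze (s1, s2) Sa =
          {(Tau, l, m) | l m. - s1 \<le> s2 * l - s1 * m \<and> s2 * l - s1 * m < 2 * s2} \<union>
          {(Phi, l, m) | l m. - s1 \<le> s2 * l - s1 * m \<and> s2 * l - s1 * m < s2} \<union>
          {(Psi, l, m) | l m. s2 - s1 \<le> s2 * l - s1 * m \<and> s2 * l - s1 * m < 2 * s2}) \<and>
     (\<forall>s1 s2. s1 > 0 \<and> s2 < 0 \<longrightarrow>
        well_posed GD (s1, s2) Sb \<and>
        squeeze (s1, s2) Sb =
          {(Tau, l, m) | l m. 0 \<le> \<bar>s2\<bar> * l + s1 * m \<and> \<bar>s2\<bar> * l + s1 * m < 2 * \<bar>s2\<bar> + s1} \<union>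
          {(Phi, l, m) | l m. 0 \<le> \<bar>s2\<bar> * l + s1 * m \<and> \<bar>s2\<bar> * l + s1 * m < \<bar>s2\<bar> + s1} \<union>
          {(Psi, l, m) | l m. \<bar>s2\<bar> \<le> \<bar>s2\<bar> * l + s1 * m \<and> \<bar>s2\<bar> * l + s1 * m < 2 * \<bar>s2\<bar> + s1})"
proof (intro conjI allI impI; (elim conjE)?)
  fix s1 s2 :: int assume s: "s1 > 0" "s2 > 0"
  show "well_posed GD (s1, s2) Sa"
    unfolding GD_def using assms(2-4) s by (intro well_posed_positive_slope) (simp_all add: Sa_def)
  show "squeeze (s1, s2) Sa =
          {(Tau, l, m) | l m. - s1 \<le> s2 * l - s1 * m \<and> s2 * l - s1 * m < 2 * s2} \<union>
          {(Phi, l, m) | l m. - s1 \<le> s2 * l - s1 * m \<and> s2 * l - s1 * m < s2} \<union>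
          {(Psi, l, m) | l m. s2 - s1 \<le> s2 * l - s1 * m \<and> s2 * l - s1 * m < 2 * s2}"
    using s unfolding squeeze_def widened_bands_def
    by (auto simp: Sa_def left_line_def right_line_def line_no_def split: dvar.splits)
next
  fix s1 s2 :: int assume s: "s1 > 0" "s2 < 0"
  show "well_posed GD (s1, s2) Sb"
    unfolding GD_def using assms(1) s by (intro well_posed_negative_slope) (simp_all add: Sb_def)
  show "squeeze (s1, s2) Sb =
          {(Tau, l, m) | l m. 0 \<le> \<bar>s2\<bar> * l + s1 * m \<and> \<bar>s2\<bar> * l + s1 * m < 2 * \<bar>s2\<bar> + s1} \<union>
          {(Phi, l, m) | l m. 0 \<le> \<bar>s2\<bar> * l + s1 * m \<and> \<bar>s2\<bar> * l + s1 * m < \<bar>s2\<bar> + s1} \<union>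
          {(Psi, l, m) | l m. \<bar>s2\<bar> \<le> \<bar>s2\<bar> * l + s1 * m \<and> \<bar>s2\<bar> * l + s1 * m < 2 * \<bar>s2\<bar> + s1}"
    using s unfolding squeeze_def widened_bands_def
    by (auto simp: Sb_def left_line_def right_line_def line_no_def split: dvar.splits)
qed

end
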